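(* The set $\mathcal{P}_{\rm CI}$ is dense in $\mathcal{P}([0,1]^d)$ with respect to weak convergence of probability measures. Moreover, there is an absolute constant $C>0$ such that, if $d\ge3$ and $n\ge8$, $$\inf_{E_n}\sup_{\mu\in\mathcal{P}_{\rm CI}}\int\mathcal{W}(E_n,\mu)\,d\mu^{\otimes n}\ge C\,n^{-1/d},$$ where the infimum ranges over all measurable maps $E_n:([0,1]^d)^n\to\mathcal{P}([0,1]^d)$.
   Context: $[0,1]^d=\mathcal{X}_1\times\dots\times\mathcal{X}_K$ with $\mathcal{X}_k=[0,1]^{d_k}$, $\sum_{k=1}^Kd_k=d$, and for $I\subseteq\{1,\dots,K\}$, $x_I=(x_k)_{k\in I}$. $\mathcal{P}([0,1]^d)$ is the set of Borel probability measures on $[0,1]^d$ and $\mathcal{W}$ is the first-order Wasserstein distance with respect to the sup-norm. $\mathcal{P}_{\rm CI}$ is the set of $\mu\in\mathcal{P}([0,1]^d)$ such that for $X\sim\mu$ and any pairwise disjoint non-empty sets $I,J,J'\subset\{1,\dots,K\}$, conditionally on $X_I$, the random vectors $X_J$ and $X_{J'}$ are independent. *)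

theory Defs
  imports "HOL-Probability.Probability"
begin

text \<open>
  The dimensions \<open>d 1, \<dots>, d K\<close> of the blocks must be quantified inside the statement (the
  constant does not depend on them), so \<open>[0,1]\<^sup>d\<close> is not rendered by a type. A point of
  \<open>X\<^sub>1 \<times> \<dots> \<times> X\<^sub>K\<close> is an extensional function \<open>x\<close> with \<open>x k \<in> [0,1]\<^bsup>d k\<^esup>\<close> itself an extensional
  function, so that \<open>x\<^sub>I\<close> is \<open>restrict x I\<close>. As finitely many coordinates are involved, the product
  sigma-algebras below are the Borel ones.
\<close>

definition unit_cube :: "nat \<Rightarrow> (nat \<Rightarrow> real) measure" where
  "unit_cube m = PiM {1..m} (\<lambda>_. restrict_space borel {0..1})"

definition blocks :: "(nat \<Rightarrow> nat) \<Rightarrow> nat set \<Rightarrow> (nat \<Rightarrow> nat \<Rightarrow> real) measure" where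
  "blocks d I = PiM I (\<lambda>k. unit_cube (d k))"

abbreviation cube :: "nat \<Rightarrow> (nat \<Rightarrow> nat) \<Rightarrow> (nat \<Rightarrow> nat \<Rightarrow> real) measure" where
  "cube K d \<equiv> blocks d {1..K}"

definition sup_dist ::
  "nat \<Rightarrow> (nat \<Rightarrow> nat) \<Rightarrow> (nat \<Rightarrow> nat \<Rightarrow> real) \<Rightarrow> (nat \<Rightarrow> nat \<Rightarrow> real) \<Rightarrow> real" where
  "sup_dist K d x y = Max ((\<lambda>(k, i). \<bar>x k i - y k i\<bar>) ` (SIGMA k:{1..K}. {1..d k}))"

definition couplings :: "'a measure \<Rightarrow> 'b measure \<Rightarrow> ('a \<times> 'b) measure set" where
  "couplings \<mu> \<nu> =
    {\<pi> \<in> space (prob_algebra (\<mu> \<Otimes>\<^sub>M \<nu>)). distr \<pi> \<mu> fst = \<mu> \<and> distr \<pi> \<nu> snd = \<nu>}"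

definition wasserstein :: "('a \<Rightarrow> 'a \<Rightarrow> real) \<Rightarrow> 'a measure \<Rightarrow> 'a measure \<Rightarrow> ennreal" where
  "wasserstein \<delta> \<mu> \<nu> = (INF \<pi>\<in>couplings \<mu> \<nu>. \<integral>\<^sup>+ z. ennreal (\<delta> (fst z) (snd z)) \<partial>\<pi>)"

text \<open>
  The coarsest topology on the probability measures on \<open>M\<close> that makes \<open>\<mu> \<mapsto> \<integral> f d\<mu>\<close> continuous for
  every bounded continuous \<open>f\<close>. On \<open>space (cube K d)\<close> the topology of the function type induces the
  Euclidean one, since all coordinates outside the index sets are constant there.
\<close>

definition weak_topology :: "'a::topological_space measure \<Rightarrow> 'a measure topology" where
  "weak_topology M = topology_generated_by
    {{\<mu> \<in> space (prob_algebra M). (\<integral>x. f x \<partial>\<mu>) \<in> U} | (f :: 'a \<Rightarrow> real) U.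
      continuous_on (space M) f \<and> bounded (f ` space M) \<and> open U}"

text \<open>
  \<open>X\<close> and \<open>Y\<close>, with values in \<open>S\<close> and \<open>T\<close>, are independent conditionally on \<open>Z\<close>, with values in \<open>N\<close>.
\<close>

definition cond_indep_var ::
  "'a measure \<Rightarrow> 'c measure \<Rightarrow> ('a \<Rightarrow> 'c) \<Rightarrow> 'b measure \<Rightarrow> ('a \<Rightarrow> 'b) \<Rightarrow> 'e measure \<Rightarrow> ('a \<Rightarrow> 'e) \<Rightarrow> bool"
where
  "cond_indep_var M N Z S X T Y \<longleftrightarrow>
    (let F = vimage_algebra (space M) Z N in
     \<forall>A\<in>sets S. \<forall>B\<in>sets T. AE \<omega> in M.
       real_cond_exp M F (\<lambda>\<omega>. indicator A (X \<omega>) * indicator B (Y \<omega>)) \<omega> =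
       real_cond_exp M F (\<lambda>\<omega>. indicator A (X \<omega>)) \<omega> *
       real_cond_exp M F (\<lambda>\<omega>. indicator B (Y \<omega>)) \<omega>)"

definition P_CI :: "nat \<Rightarrow> (nat \<Rightarrow> nat) \<Rightarrow> (nat \<Rightarrow> nat \<Rightarrow> real) measure set" where
  "P_CI K d = {\<mu> \<in> space (prob_algebra (cube K d)).
    \<forall>I J J'. I \<subseteq> {1..K} \<and> J \<subseteq> {1..K} \<and> J' \<subseteq> {1..K} \<and>
      I \<noteq> {} \<and> J \<noteq> {} \<and> J' \<noteq> {} \<and> I \<inter> J = {} \<and> I \<inter> J' = {} \<and> J \<inter> J' = {} \<longrightarrow>
      cond_indep_var \<mu> (blocks d I) (\<lambda>x. restrict x I)
        (blocks d J) (\<lambda>x. restrict x J) (blocks d J') (\<lambda>x. restrict x J')}"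

end

theory Submission
  imports Defs
begin

text \<open>
  If a measure has finite support and any single block of a support point determines the whole
  point, then conditioning on a nonempty set of blocks leaves nothing random, and the measure lies
  in \<open>P_CI\<close>. The points of a grid can be perturbed, by shifts smaller than the mesh, so that every
  coordinate determines the point. Rounding to finer and finer perturbed grids gives density. For the
  lower bound, take \<open>4n\<close> perturbed grid points, pair them up, and consider the uniform distributions
  on the choices of one point from each of the \<open>2n\<close> pairs. A sample of size \<open>n\<close> leaves at least \<open>n\<close>
  pairs unobserved, and flipping the choice in these pairs moves mass at least \<open>1/2\<close> over a distance
  of order \<open>n\<^sup>-\<^sup>1\<^sup>/\<^sup>d\<close> without changing the observed sample.
\<close>

section \<open>Finitely supported measures in \<open>P_CI\<close>\<close>

lemma space_blocks: "space (blocks d I) = (PiE I (\<lambda>k. PiE {1..d k} (\<lambda>_. {0..1})))"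
  by (simp add: blocks_def unit_cube_def space_PiM space_restrict_space)

lemma block_singleton_sets:
  assumes "u \<in> space (unit_cube m)"
  shows "{u} \<in> sets (unit_cube m)"
proof -
  have u: "u \<in> PiE {1..m} (\<lambda>_. {0..1})"
    using assms by (simp add: unit_cube_def space_PiM space_restrict_space)
  have "PiE {1..m} (\<lambda>i. {u i}) \<in> sets (unit_cube m)"
    unfolding unit_cube_def using u
    by (intro sets_PiM_I_finite) (auto simp: sets_restrict_space_iff PiE_iff)
  moreover have "PiE {1..m} (\<lambda>i. {u i}) = {u}"
    using u by (intro PiE_singleton) (auto simp: PiE_def)
  ultimately show ?thesis by simp
qed

lemma singleton_sets_cube:
  assumes "x \<in> space (cube K d)"
  shows "{x} \<in> sets (cube K d)"
proof -
  have x: "x \<in> PiE {1..K} (\<lambda>k. space (unit_cube (d k)))"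
    using assms by (simp add: blocks_def space_PiM)
  have "PiE {1..K} (\<lambda>k. {x k}) \<in> sets (cube K d)"
    unfolding blocks_def using x
    by (intro sets_PiM_I_finite) (auto simp: block_singleton_sets PiE_iff)
  moreover have "PiE {1..K} (\<lambda>k. {x k}) = {x}"
    using x by (intro PiE_singleton) (auto simp: PiE_def)
  ultimately show ?thesis by simp
qed

lemma restrict_block_measurable:
  assumes "J \<subseteq> {1..K}"
  shows "(\<lambda>x. restrict x J) \<in> cube K d \<rightarrow>\<^sub>M blocks d J"
  unfolding blocks_def using assms by (rule measurable_restrict_subset)

text \<open>On the support every block determines the whole point, so conditioning on any nonempty
  set of blocks leaves nothing random.\<close>

lemma real_cond_exp_block_injective:
  fixes h :: "(nat \<Rightarrow> nat \<Rightarrow> real) \<Rightarrow> real"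
  assumes mu: "\<mu> \<in> space (prob_algebra (cube K d))"
    and S: "finite S" "S \<subseteq> space (cube K d)" "AE x in \<mu>. x \<in> S"
    and inj: "inj_on (\<lambda>x. x i) S" and I: "I \<subseteq> {1..K}" "i \<in> I"
    and h: "integrable \<mu> h"
  shows "AE x in \<mu>. real_cond_exp \<mu> (vimage_algebra (space \<mu>) (\<lambda>x. restrict x I) (blocks d I)) h x = h x"
proof -
  let ?F = "vimage_algebra (space \<mu>) (\<lambda>x. restrict x I) (blocks d I)"
  have sets_mu: "sets \<mu> = sets (cube K d)" and "prob_space \<mu>"
    using mu by (auto simp: space_prob_algebra)
  then interpret prob_space \<mu> by simp
  have res: "(\<lambda>x. restrict x I) \<in> \<mu> \<rightarrow>\<^sub>M blocks d I"
    using restrict_block_measurable[OF I(1)] sets_mu by (simp cong: measurable_cong_sets)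
  have "subalgebra \<mu> ?F"
    unfolding subalgebra_def
    using measurable_space[OF res] measurable_sets[OF res]
    by (auto simp: sets_vimage_algebra2 Pi_iff)
  then interpret finite_measure_subalgebra \<mu> ?F
    by unfold_locales
  \<comment> \<open>\<open>g\<close> is a version of \<open>h\<close> that depends on
    \<open>x\<close> only through \<open>x i\<close>. By injectivity at most one
    \<open>s \<in> S\<close> contributes, so \<open>g\<close> agrees with \<open>h\<close> on
    \<open>S\<close>, and it is measurable for the conditioning sigma-algebra.\<close>
  define g where "g = (\<lambda>x. \<Sum>s\<in>S. h s * indicator {y. y i = s i} x)"
  have resF: "(\<lambda>x. restrict x I) \<in> ?F \<rightarrow>\<^sub>M blocks d I"
    using measurable_space[OF res] by (intro measurable_vimage_algebra1) auto
  have coord: "(\<lambda>x. x i) \<in> ?F \<rightarrow>\<^sub>M unit_cube (d i)"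
  proof -
    have "(\<lambda>x. restrict x I i) \<in> ?F \<rightarrow>\<^sub>M unit_cube (d i)"
      using measurable_compose[OF resF[unfolded blocks_def] measurable_component_singleton[OF I(2)]]
      by (simp add: blocks_def)
    then show ?thesis using I(2) by simp
  qed
  have "(\<lambda>x. h s * indicator {y. y i = s i} x :: real) \<in> borel_measurable ?F" if "s \<in> S" for s
  proof -
    have "s i \<in> space (unit_cube (d i))"
      using that S(2) I by (auto simp: blocks_def space_PiM)
    then have "{s i} \<in> sets (unit_cube (d i))" by (rule block_singleton_sets)
    from measurable_sets[OF coord this] have m: "{y. y i = s i} \<inter> space ?F \<in> sets ?F"
      by (simp add: vimage_def)
    show ?thesis
      using m by (intro borel_measurable_times) (auto simp: borel_measurable_indicator_iff)
  qed
  then have gF: "g \<in> borel_measurable ?F"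
    unfolding g_def by (intro borel_measurable_sum)
  have gM: "g \<in> borel_measurable \<mu>"
    using gF subalg measurable_from_subalg by blast
  have gh: "g x = h x" if "x \<in> S" for x
  proof -
    have "g x = (\<Sum>s\<in>S. if s = x then h s else 0)"
      unfolding g_def using inj that by (intro sum.cong) (auto simp: inj_on_def indicator_def)
    then show ?thesis using S(1) that by simp
  qed
  have ae: "AE x in \<mu>. h x = g x"
    using S(3) by eventually_elim (simp add: gh)
  have hM: "h \<in> borel_measurable \<mu>" using h by simp
  have "integrable \<mu> g"
    using h ae hM gM integrable_cong_AE by blast
  from real_cond_exp_F_meas[OF this gF] real_cond_exp_cong[OF ae hM gM] ae
  show ?thesis by eventually_elim simp
qed

text \<open>Each of the three conditional expectations equals its integrand almost everywhere, so
  the required factorization turns into the identity of a product of two indicators with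
  itself.\<close>

lemma block_injective_in_P_CI:
  assumes mu: "\<mu> \<in> space (prob_algebra (cube K d))"
    and S: "finite S" "S \<subseteq> space (cube K d)" "AE x in \<mu>. x \<in> S"
    and inj: "\<And>k. k \<in> {1..K} \<Longrightarrow> inj_on (\<lambda>x. x k) S"
  shows "\<mu> \<in> P_CI K d"
  unfolding P_CI_def mem_Collect_eq
proof (intro conjI allI impI mu)
  fix I J J' :: "nat set"
  assume H: "I \<subseteq> {1..K} \<and> J \<subseteq> {1..K} \<and> J' \<subseteq> {1..K} \<and>
      I \<noteq> {} \<and> J \<noteq> {} \<and> J' \<noteq> {} \<and> I \<inter> J = {} \<and> I \<inter> J' = {} \<and> J \<inter> J' = {}"
  then obtain i where i: "i \<in> I" by auto
  have sets_mu: "sets \<mu> = sets (cube K d)" and "prob_space \<mu>"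
    using mu by (auto simp: space_prob_algebra)
  then interpret prob_space \<mu> by simp
  have meas: "(\<lambda>\<omega>. indicator A (restrict \<omega> L) :: real) \<in> borel_measurable \<mu>"
    if "L \<subseteq> {1..K}" "A \<in> sets (blocks d L)" for A L
  proof -
    have "(\<lambda>x. restrict x L) \<in> \<mu> \<rightarrow>\<^sub>M blocks d L"
      using restrict_block_measurable[OF that(1)] sets_mu by (simp cong: measurable_cong_sets)
    from measurable_compose[OF this borel_measurable_indicator[OF that(2)]] show ?thesis .
  qed
  note cond = real_cond_exp_block_injective[OF mu S inj, of i I]
  show "cond_indep_var \<mu> (blocks d I) (\<lambda>x. restrict x I)
        (blocks d J) (\<lambda>x. restrict x J) (blocks d J') (\<lambda>x. restrict x J')"
    unfolding cond_indep_var_def Let_def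
  proof (intro ballI)
    fix A B assume A: "A \<in> sets (blocks d J)" and B: "B \<in> sets (blocks d J')"
    have m: "(\<lambda>\<omega>. indicator A (restrict \<omega> J) :: real) \<in> borel_measurable \<mu>"
      "(\<lambda>\<omega>. indicator B (restrict \<omega> J') :: real) \<in> borel_measurable \<mu>"
      using meas A B H by blast+
    have int: "integrable \<mu> (\<lambda>\<omega>. indicator A (restrict \<omega> J) :: real)"
      "integrable \<mu> (\<lambda>\<omega>. indicator B (restrict \<omega> J') :: real)"
      "integrable \<mu> (\<lambda>\<omega>. indicator A (restrict \<omega> J) * indicator B (restrict \<omega> J') :: real)"
      using m by (auto intro!: integrable_const_bound[where B=1] simp: indicator_def)
    have iK: "i \<in> {1..K}" "I \<subseteq> {1..K}" using i H by auto
    show "AE \<omega> in \<mu>.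
       real_cond_exp \<mu> (vimage_algebra (space \<mu>) (\<lambda>x. restrict x I) (blocks d I))
         (\<lambda>\<omega>. indicator A (restrict \<omega> J) * indicator B (restrict \<omega> J')) \<omega> =
       real_cond_exp \<mu> (vimage_algebra (space \<mu>) (\<lambda>x. restrict x I) (blocks d I))
         (\<lambda>\<omega>. indicator A (restrict \<omega> J)) \<omega> *
       real_cond_exp \<mu> (vimage_algebra (space \<mu>) (\<lambda>x. restrict x I) (blocks d I))
         (\<lambda>\<omega>. indicator B (restrict \<omega> J')) \<omega>"
      using cond[OF iK i int(1)] cond[OF iK i int(2)] cond[OF iK i int(3)]
      by eventually_elim simp
  qed
qed

section \<open>Perturbed grids in the cube\<close>

lemma coordinate_measurable:
  assumes "k \<in> {1..K}" "i \<in> {1..d k}"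
  shows "(\<lambda>x. x k i) \<in> borel_measurable (cube K d)"
proof -
  have 1: "(\<lambda>x. x k) \<in> cube K d \<rightarrow>\<^sub>M unit_cube (d k)"
    unfolding blocks_def using assms by (intro measurable_component_singleton)
  have 2: "(\<lambda>y. y i) \<in> unit_cube (d k) \<rightarrow>\<^sub>M restrict_space borel {0..1}"
    unfolding unit_cube_def using assms by (intro measurable_component_singleton)
  show ?thesis
    using measurable_compose[OF 1 2] by (simp add: measurable_restrict_space2_iff)
qed

definition grid_index :: "nat \<Rightarrow> (nat \<Rightarrow> nat) \<Rightarrow> nat \<Rightarrow> (nat \<Rightarrow> nat \<Rightarrow> nat) set" where
  "grid_index K d m = PiE {1..K} (\<lambda>k. PiE {1..d k} (\<lambda>_. {..<m}))"

lemma finite_grid_index: "finite (grid_index K d m)"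
  unfolding grid_index_def by (intro finite_PiE) auto

lemma card_grid_index: "card (grid_index K d m) = m ^ (\<Sum>k=1..K. d k)"
  unfolding grid_index_def by (simp add: card_PiE power_sum)

text \<open>The cap \<open>m - 1\<close> puts a coordinate equal to 1 into the last cell.\<close>

definition grid_cell :: "nat \<Rightarrow> (nat \<Rightarrow> nat) \<Rightarrow> nat \<Rightarrow> (nat \<Rightarrow> nat \<Rightarrow> real) \<Rightarrow> nat \<Rightarrow> nat \<Rightarrow> nat" where
  "grid_cell K d m x = (\<lambda>k\<in>{1..K}. \<lambda>i\<in>{1..d k}. min (m - 1) (nat \<lfloor>m * x k i\<rfloor>))"

text \<open>There are finitely many indices, so measurability of the fibres suffices. A fibre is a
  finite intersection of conditions on single coordinates, because extensional indices agree once
  their coordinates do.\<close>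

lemma grid_cell_measurable:
  assumes "m \<ge> 1"
  shows "grid_cell K d m \<in> cube K d \<rightarrow>\<^sub>M count_space (grid_index K d m)"
  unfolding measurable_count_space_eq2[OF finite_grid_index]
proof (intro conjI ballI)
  show "grid_cell K d m \<in> space (cube K d) \<rightarrow> grid_index K d m"
    using assms by (auto simp: grid_cell_def grid_index_def min_def)
  fix q assume q: "q \<in> grid_index K d m"
  have eq: "grid_cell K d m x = q \<longleftrightarrow>
      (\<forall>k\<in>{1..K}. \<forall>i\<in>{1..d k}. min (m - 1) (nat \<lfloor>m * x k i\<rfloor>) = q k i)"
    for x :: "nat \<Rightarrow> nat \<Rightarrow> real"
  proof
    assume *: "\<forall>k\<in>{1..K}. \<forall>i\<in>{1..d k}. min (m - 1) (nat \<lfloor>m * x k i\<rfloor>) = q k i"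
    show "grid_cell K d m x = q"
    proof (rule extensionalityI[of _ "{1..K}"])
      fix k assume k: "k \<in> {1..K}"
      show "grid_cell K d m x k = q k"
        using k q * by (intro extensionalityI[of _ "{1..d k}"])
          (auto simp: grid_cell_def grid_index_def PiE_iff)
    qed (use q in \<open>auto simp: grid_cell_def grid_index_def PiE_iff\<close>)
  qed (auto simp: grid_cell_def)
  have "{x \<in> space (cube K d).
      \<forall>k\<in>{1..K}. \<forall>i\<in>{1..d k}. min (m - 1) (nat \<lfloor>m * x k i\<rfloor>) = q k i} \<in> sets (cube K d)"
  proof (intro sets.sets_Collect_finite_All)
    fix k i assume "k \<in> {1..K}" "i \<in> {1..d k}"
    note [measurable] = coordinate_measurable[where d = d, OF this]
    show "{x \<in> space (cube K d). min (m - 1) (nat \<lfloor>m * x k i\<rfloor>) = q k i} \<in> sets (cube K d)"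
      by measurable
  qed auto
  then show "grid_cell K d m -` {q} \<inter> space (cube K d) \<in> sets (cube K d)"
    by (simp add: eq vimage_def Int_def conj_commute)
qed

text \<open>The grid points are shifted by pairwise distinct offsets, smaller than half the mesh, so that
  every single coordinate identifies the point.\<close>

lemma grid_points_exist:
  assumes m: "m \<ge> 1" and d: "\<And>k. k \<in> {1..K} \<Longrightarrow> d k \<ge> 1"
  obtains p where
    "p \<in> grid_index K d m \<rightarrow> space (cube K d)"
    "\<And>q k i. q \<in> grid_index K d m \<Longrightarrow> k \<in> {1..K} \<Longrightarrow> i \<in> {1..d k} \<Longrightarrow>
      real (q k i) / m \<le> p q k i \<and> p q k i \<le> (real (q k i) + 1/2) / m"
    "\<And>k. k \<in> {1..K} \<Longrightarrow> inj_on (\<lambda>x. x k) (p ` grid_index K d m)"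
proof -
  obtain e :: "_ \<Rightarrow> nat" where e: "inj_on e (grid_index K d m)"
    using finite_imp_inj_to_nat_seg[OF finite_grid_index] by metis
  \<comment> \<open>The \<open>+ 2\<close> keeps every offset in (0, 1/2], so the point stays in the
    lower half of its cell. The injective numbering \<open>e\<close> makes the offsets
    distinct.\<close>
  define p where "p = (\<lambda>q. \<lambda>k\<in>{1..K}. \<lambda>i\<in>{1..d k}. (real (q k i) + 1 / (real (e q) + 2)) / m)"
  have off: "0 < 1 / (real (e q) + 2)" "1 / (real (e q) + 2) \<le> 1/2" for q
    by (simp_all add: field_simps)
  have q_less: "real (q k i) + 1 \<le> m" if "q \<in> grid_index K d m" "k \<in> {1..K}" "i \<in> {1..d k}" for q k i
  proof -
    have "q k i < m" using that by (auto simp: grid_index_def PiE_iff)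
    then show ?thesis by linarith
  qed
  have bounds: "real (q k i) / m \<le> p q k i \<and> p q k i \<le> (real (q k i) + 1/2) / m"
    if "k \<in> {1..K}" "i \<in> {1..d k}" for q k i
    unfolding p_def using that off[of q] m by (auto intro!: divide_right_mono)
  have in_unit: "0 \<le> p q k i \<and> p q k i \<le> 1"
    if "q \<in> grid_index K d m" "k \<in> {1..K}" "i \<in> {1..d k}" for q k i
  proof -
    have "(real (q k i) + 1/2) / m \<le> 1" using q_less[OF that] m by (simp add: field_simps)
    moreover have "0 \<le> real (q k i) / m" by simp
    ultimately show ?thesis using bounds[OF that(2,3)] by (meson order_trans)
  qed
  have space: "p \<in> grid_index K d m \<rightarrow> space (cube K d)"
    using in_unit by (auto simp: space_blocks PiE_iff extensional_def p_def)
  have inj: "inj_on (\<lambda>x. x k) (p ` grid_index K d m)" if k: "k \<in> {1..K}" for k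
  proof (rule inj_onI, clarify)
    fix q r assume q: "q \<in> grid_index K d m" and r: "r \<in> grid_index K d m" and eq: "p q k = p r k"
    have 1: "1 \<in> {1..d k}" using d[OF k] by simp
    have "p q k 1 = p r k 1" using eq by simp
    then have eq1: "real (q k 1) + 1 / (real (e q) + 2) = real (r k 1) + 1 / (real (e r) + 2)"
      using k 1 m by (simp add: p_def)
    \<comment> \<open>Two offsets differ by less than 1, which forces the integer parts to agree.
      Then the offsets agree, and with them the numbers \<open>e q\<close> and
      \<open>e r\<close>.\<close>
    then have "\<bar>real (q k 1) - real (r k 1)\<bar> < 1"
      using off[of q] off[of r] by linarith
    then have "q k 1 = r k 1" by linarith
    with eq1 have "e q = e r" by (simp add: field_simps)
    then have "q = r" using e q r by (auto dest: inj_onD)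
    then show "p q = p r" by simp
  qed
  show ?thesis by (rule that[OF space bounds inj])
qed

lemma grid_cell_bounds:
  assumes "m \<ge> 1" "x \<in> space (cube K d)" "k \<in> {1..K}" "i \<in> {1..d k}"
  shows "real (grid_cell K d m x k i) / m \<le> x k i \<and> x k i \<le> (real (grid_cell K d m x k i) + 1) / m"
proof -
  have x: "0 \<le> x k i" "x k i \<le> 1"
    using assms by (auto simp: space_blocks PiE_iff)
  define c where "c = grid_cell K d m x k i"
  have c: "c = min (m - 1) (nat \<lfloor>m * x k i\<rfloor>)"
    using assms by (simp add: c_def grid_cell_def)
  have mx: "0 \<le> m * x k i" "m * x k i \<le> m"
    using x by (simp_all add: mult_left_le)
  have "real c \<le> m * x k i"
    using mx unfolding c by linarith
  moreover have "m * x k i \<le> real c + 1"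
    using mx assms(1) unfolding c by linarith
  ultimately show ?thesis
    using assms(1) by (simp add: c_def field_simps)
qed

text \<open>Distinct indices differ by at least one full mesh in some coordinate. The shifts are
  upward and at most half a mesh, so at least half of that gap survives.\<close>

lemma grid_separated:
  assumes m: "m \<ge> 1"
    and p: "\<And>q k i. q \<in> grid_index K d m \<Longrightarrow> k \<in> {1..K} \<Longrightarrow> i \<in> {1..d k} \<Longrightarrow>
      real (q k i) / m \<le> p q k i \<and> p q k i \<le> (real (q k i) + 1/2) / m"
    and q: "q \<in> grid_index K d m" "r \<in> grid_index K d m" "q \<noteq> r"
  shows "sup_dist K d (p q) (p r) \<ge> 1 / (2 * m)"
proof -
  have "\<exists>k\<in>{1..K}. \<exists>i\<in>{1..d k}. q k i \<noteq> r k i"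
  proof (rule ccontr)
    assume "\<not> ?thesis"
    then have same: "k \<in> {1..K} \<Longrightarrow> i \<in> {1..d k} \<Longrightarrow> q k i = r k i" for k i by blast
    have "q = r"
    proof (rule extensionalityI[of _ "{1..K}"])
      fix k assume "k \<in> {1..K}"
      then show "q k = r k"
        using q same by (intro extensionalityI[of _ "{1..d k}"]) (auto simp: grid_index_def PiE_iff)
    qed (use q in \<open>auto simp: grid_index_def PiE_iff\<close>)
    with q show False by simp
  qed
  then obtain k i where ki: "k \<in> {1..K}" "i \<in> {1..d k}" "q k i \<noteq> r k i" by blast
  have gap: "1 / (2 * m) \<le> \<bar>p u k i - p v k i\<bar>"
    if uv: "u \<in> grid_index K d m" "v \<in> grid_index K d m" "u k i < v k i" for u v
  proof -
    have "real (u k i) + 1 \<le> real (v k i)" using uv(3) by linarith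
    then have "(real (u k i) + 1) / m \<le> real (v k i) / m" by (intro divide_right_mono) auto
    then have "(real (u k i) + 1) / m \<le> p v k i" using p[OF uv(2) ki(1,2)] by linarith
    moreover have "p u k i \<le> (real (u k i) + 1/2) / m" using p[OF uv(1) ki(1,2)] by blast
    ultimately have "(real (u k i) + 1) / m - (real (u k i) + 1/2) / m \<le> p v k i - p u k i"
      by linarith
    moreover have "(real (u k i) + 1) / m - (real (u k i) + 1/2) / m = 1 / (2 * m)"
      using m by (simp add: field_simps)
    ultimately show ?thesis by linarith
  qed
  have "1 / (2 * m) \<le> \<bar>p q k i - p r k i\<bar>"
  proof (cases "q k i < r k i")
    case True
    then show ?thesis using gap q by blast
  next
    case False
    then show ?thesis using gap[of r q] q ki(3) by (simp add: abs_minus_commute)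
  qed
  also have "\<dots> \<le> sup_dist K d (p q) (p r)"
    unfolding sup_dist_def using ki by (intro Max_ge) (auto intro!: image_eqI[of _ _ "(k, i)"])
  finally show ?thesis by simp
qed

section \<open>Density in the weak topology\<close>

lemma topspace_weak_topology: "topspace (weak_topology M) = space (prob_algebra M)"
proof -
  \<comment> \<open>The zero function with \<open>U = UNIV\<close> makes the whole space a subbasic
    set.\<close>
  have "space (prob_algebra M) \<in> {{\<mu> \<in> space (prob_algebra M). (\<integral>x. f x \<partial>\<mu>) \<in> U} | (f :: 'a \<Rightarrow> real) U.
      continuous_on (space M) f \<and> bounded (f ` space M) \<and> open U}"
    by (rule CollectI, intro exI[of _ "\<lambda>_. 0"] exI[of _ UNIV])
      (auto intro: continuous_on_const simp: image_constant_conv)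
  then show ?thesis
    unfolding weak_topology_def topology_generated_by_topspace by blast
qed

text \<open>The sequence eventually enters every subbasic set containing \<mu>, and this property
  passes to finite intersections and arbitrary unions. Induction over the generation of an open set
  therefore covers every neighbourhood of \<mu>.\<close>

lemma weak_limit_in_closure:
  assumes mu: "\<mu> \<in> space (prob_algebra M)"
    and nu: "\<And>n. \<nu> n \<in> A" "\<And>n. \<nu> n \<in> space (prob_algebra M)"
    and lim: "\<And>f :: 'a::topological_space \<Rightarrow> real. continuous_on (space M) f \<Longrightarrow> bounded (f ` space M) \<Longrightarrow>
      (\<lambda>n. \<integral>x. f x \<partial>(\<nu> n)) \<longlonglongrightarrow> (\<integral>x. f x \<partial>\<mu>)"
  shows "\<mu> \<in> weak_topology M closure_of A"
  unfolding in_closure_of topspace_weak_topology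
proof (intro conjI mu allI impI)
  fix T assume T: "\<mu> \<in> T \<and> openin (weak_topology M) T"
  then have "generate_topology_on {{\<mu> \<in> space (prob_algebra M). (\<integral>x. f x \<partial>\<mu>) \<in> U} | (f :: 'a \<Rightarrow> real) U.
      continuous_on (space M) f \<and> bounded (f ` space M) \<and> open U} T"
    by (simp add: weak_topology_def openin_topology_generated_by_iff)
  then have "\<mu> \<in> T \<longrightarrow> (\<forall>\<^sub>F n in sequentially. \<nu> n \<in> T)"
  proof induction
    case (Int a b)
    then show ?case by (auto simp: eventually_conj_iff)
  next
    case (UN L)
    show ?case
    proof
      assume "\<mu> \<in> \<Union>L"
      then obtain k where k: "k \<in> L" "\<mu> \<in> k" by blast
      with UN have "\<forall>\<^sub>F n in sequentially. \<nu> n \<in> k" by blast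
      then show "\<forall>\<^sub>F n in sequentially. \<nu> n \<in> \<Union>L"
        by eventually_elim (use k in blast)
    qed
  next
    case (Basis s)
    then obtain f :: "'a \<Rightarrow> real" and U where s: "s = {\<mu> \<in> space (prob_algebra M). (\<integral>x. f x \<partial>\<mu>) \<in> U}"
      and f: "continuous_on (space M) f" "bounded (f ` space M)" and U: "open U"
      by blast
    show ?case
    proof
      assume "\<mu> \<in> s"
      then have "\<forall>\<^sub>F n in sequentially. (\<integral>x. f x \<partial>(\<nu> n)) \<in> U"
        using topological_tendstoD[OF lim[OF f] U] s by simp
      then show "\<forall>\<^sub>F n in sequentially. \<nu> n \<in> s"
        by eventually_elim (use nu in \<open>simp add: s\<close>)
    qed
  qed simp
  with T have "\<forall>\<^sub>F n in sequentially. \<nu> n \<in> T" by simp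
  then obtain n where "\<nu> n \<in> T" by (auto simp: eventually_sequentially)
  with nu show "\<exists>y. y \<in> A \<and> y \<in> T" by blast
qed

text \<open>Each point moves to the perturbed grid point of its own cell, at most one mesh away in
  every coordinate. The finite, blockwise injective range is what places the image measures in
  \<open>P_CI\<close>.\<close>

lemma finite_range_discretization:
  fixes m :: nat
  assumes m: "m \<ge> 1" and d: "\<And>k. k \<in> {1..K} \<Longrightarrow> d k \<ge> 1"
  obtains g Q where "g \<in> cube K d \<rightarrow>\<^sub>M count_space Q" "finite Q" "Q \<subseteq> space (cube K d)"
    "\<And>k. k \<in> {1..K} \<Longrightarrow> inj_on (\<lambda>x. x k) Q"
    "\<And>x k i. x \<in> space (cube K d) \<Longrightarrow> \<bar>g x k i - x k i\<bar> \<le> 1 / m"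
proof -
  obtain p where p: "p \<in> grid_index K d m \<rightarrow> space (cube K d)"
    "\<And>q k i. q \<in> grid_index K d m \<Longrightarrow> k \<in> {1..K} \<Longrightarrow> i \<in> {1..d k} \<Longrightarrow>
      real (q k i) / m \<le> p q k i \<and> p q k i \<le> (real (q k i) + 1/2) / m"
    "\<And>k. k \<in> {1..K} \<Longrightarrow> inj_on (\<lambda>x. x k) (p ` grid_index K d m)"
    by (rule grid_points_exist[OF m d]) blast+
  note cell = grid_cell_measurable[OF m, of K d]
  have "(\<lambda>x. p (grid_cell K d m x)) \<in> cube K d \<rightarrow>\<^sub>M count_space (p ` grid_index K d m)"
    by (rule measurable_compose[OF cell]) (auto simp: measurable_count_space_eq1)
  moreover have "\<bar>p (grid_cell K d m x) k i - x k i\<bar> \<le> 1 / m" if x: "x \<in> space (cube K d)" for x k i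
  proof (cases "k \<in> {1..K} \<and> i \<in> {1..d k}")
    case True
    have "grid_cell K d m x \<in> grid_index K d m"
      using measurable_space[OF cell x] by simp
    note * = p(2)[OF this] grid_cell_bounds[OF m x]
    let ?c = "real (grid_cell K d m x k i)"
    have "(?c + 1/2) / m \<le> (?c + 1) / m" by (intro divide_right_mono) auto
    moreover have "(?c + 1) / m = ?c / m + 1 / m" by (simp add: add_divide_distrib)
    ultimately show ?thesis using *[of k i] True by linarith
  next
    \<comment> \<open>Outside the index sets both points are extensional and share the default
      value, so the bound holds for all \<open>k\<close> and \<open>i\<close>.\<close>
    case False
    have "p (grid_cell K d m x) \<in> space (cube K d)"
      using measurable_space[OF cell x] p(1) by auto
    then have "p (grid_cell K d m x) k i = x k i"
      using x False by (cases "k \<in> {1..K}") (auto simp: space_blocks PiE_iff extensional_def)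
    then show ?thesis by simp
  qed
  ultimately show ?thesis
    by (intro that[of _ "p ` grid_index K d m"]) (use p in \<open>auto simp: finite_grid_index\<close>)
qed

text \<open>Both halves of the theorem obtain their members of \<open>P_CI\<close> here: density
  with \<open>g\<close> a rounding map, the lower bound with \<open>g\<close> an enumeration of
  chosen grid points.\<close>

lemma distr_finite_range_in_P_CI:
  assumes mu: "prob_space \<mu>"
    and g: "g \<in> \<mu> \<rightarrow>\<^sub>M count_space Q" "finite Q" "Q \<subseteq> space (cube K d)"
    and inj: "\<And>k. k \<in> {1..K} \<Longrightarrow> inj_on (\<lambda>x. x k) Q"
  shows "distr \<mu> (cube K d) g \<in> P_CI K d"
proof (rule block_injective_in_P_CI[OF _ g(2,3) _ inj])
  have meas: "g \<in> \<mu> \<rightarrow>\<^sub>M cube K d"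
    by (rule measurable_compose[OF g(1), of "\<lambda>x. x", simplified])
      (use g in \<open>auto simp: measurable_count_space_eq1\<close>)
  show "distr \<mu> (cube K d) g \<in> space (prob_algebra (cube K d))"
    using prob_space.prob_space_distr[OF mu meas] by (simp add: space_prob_algebra)
  have "Q = (\<Union>x\<in>Q. {x})" by simp
  also have "\<dots> \<in> sets (cube K d)"
    using g(2,3) by (intro sets.finite_UN singleton_sets_cube) auto
  finally have "{x \<in> space (cube K d). x \<in> Q} \<in> sets (cube K d)"
    using g(3) by (simp add: Collect_conj_eq Int_absorb1 Int_absorb2)
  then show "AE x in distr \<mu> (cube K d) g. x \<in> Q"
    using measurable_space[OF g(1)] by (subst AE_distr_iff[OF meas]) auto
qed

text \<open>The images of \<mu> under rounding to meshes \<open>1 / Suc n\<close> lie in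
  \<open>P_CI\<close>. The roundings converge pointwise to the identity, so dominated convergence
  gives convergence of the integrals of bounded continuous functions.\<close>

theorem P_CI_dense:
  assumes d: "\<And>k. k \<in> {1..K} \<Longrightarrow> d k \<ge> 1"
  shows "weak_topology (cube K d) closure_of P_CI K d = space (prob_algebra (cube K d))"
proof
  show "weak_topology (cube K d) closure_of P_CI K d \<subseteq> space (prob_algebra (cube K d))"
    using closure_of_subset_topspace by (metis topspace_weak_topology)
  show "space (prob_algebra (cube K d)) \<subseteq> weak_topology (cube K d) closure_of P_CI K d"
  proof
    fix \<mu> assume mu: "\<mu> \<in> space (prob_algebra (cube K d))"
    then have sets_mu: "sets \<mu> = sets (cube K d)" and "prob_space \<mu>"
      by (auto simp: space_prob_algebra)
    then interpret prob_space \<mu> by simp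
    have "\<exists>g Q. g \<in> cube K d \<rightarrow>\<^sub>M count_space Q \<and> finite Q \<and> Q \<subseteq> space (cube K d) \<and>
        (\<forall>k\<in>{1..K}. inj_on (\<lambda>x. x k) Q) \<and>
        (\<forall>x\<in>space (cube K d). \<forall>k i. \<bar>g x k i - x k i\<bar> \<le> 1 / Suc n)" for n
    proof -
      obtain g Q where "g \<in> cube K d \<rightarrow>\<^sub>M count_space Q" "finite Q" "Q \<subseteq> space (cube K d)"
        "\<And>k. k \<in> {1..K} \<Longrightarrow> inj_on (\<lambda>x. x k) Q"
        "\<And>x k i. x \<in> space (cube K d) \<Longrightarrow> \<bar>g x k i - x k i\<bar> \<le> 1 / Suc n"
        by (rule finite_range_discretization[of "Suc n" K d]) (use d in auto)
      then show ?thesis by (intro exI[of _ g] exI[of _ Q]) simp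
    qed
    then obtain g Q where gQ': "\<forall>n. g n \<in> cube K d \<rightarrow>\<^sub>M count_space (Q n) \<and> finite (Q n) \<and>
        Q n \<subseteq> space (cube K d) \<and> (\<forall>k\<in>{1..K}. inj_on (\<lambda>x. x k) (Q n)) \<and>
        (\<forall>x\<in>space (cube K d). \<forall>k i. \<bar>g n x k i - x k i\<bar> \<le> 1 / Suc n)"
      by metis
    then have gQ: "g n \<in> cube K d \<rightarrow>\<^sub>M count_space (Q n)" "finite (Q n)" "Q n \<subseteq> space (cube K d)"
      and gQ_inj: "k \<in> {1..K} \<Longrightarrow> inj_on (\<lambda>x. x k) (Q n)"
      and close: "x \<in> space (cube K d) \<Longrightarrow> \<bar>g n x k i - x k i\<bar> \<le> 1 / Suc n" for n x k i
      by blast+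
    have gmu: "g n \<in> \<mu> \<rightarrow>\<^sub>M count_space (Q n)" for n
      using gQ(1) unfolding measurable_cong_sets[OF sets_mu refl] .
    have gmeas: "g n \<in> \<mu> \<rightarrow>\<^sub>M cube K d" for n
      by (rule measurable_compose[OF gmu, of "\<lambda>x. x", simplified])
        (use gQ in \<open>auto simp: measurable_count_space_eq1\<close>)
    have space_mu: "space \<mu> = space (cube K d)"
      using sets_mu by (rule sets_eq_imp_space_eq)
    have P: "distr \<mu> (cube K d) (g n) \<in> P_CI K d" for n
      by (rule distr_finite_range_in_P_CI[OF prob_space_axioms gmu gQ(2,3) gQ_inj])
    show "\<mu> \<in> weak_topology (cube K d) closure_of P_CI K d"
    proof (rule weak_limit_in_closure[OF mu P])
      show "distr \<mu> (cube K d) (g n) \<in> space (prob_algebra (cube K d))" for n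
        using P by (simp add: P_CI_def)
      fix f :: "(nat \<Rightarrow> nat \<Rightarrow> real) \<Rightarrow> real"
      assume f: "continuous_on (space (cube K d)) f" "bounded (f ` space (cube K d))"
      have in_cube: "g n x \<in> space (cube K d)" if "x \<in> space (cube K d)" for n x
        using measurable_space[OF gQ(1) that] gQ(3) by auto
      have lim_g: "(\<lambda>n. g n x) \<longlonglongrightarrow> x" if x: "x \<in> space (cube K d)" for x
      proof -
        have "(\<lambda>n. g n x k i) \<longlonglongrightarrow> x k i" for k i
        proof (rule LIM_zero_cancel, rule Lim_null_comparison)
          show "\<forall>\<^sub>F n in sequentially. norm (g n x k i - x k i) \<le> 1 / Suc n"
            using close[OF x] by simp
          show "(\<lambda>n. 1 / Suc n) \<longlonglongrightarrow> (0::real)"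
            using LIMSEQ_Suc[OF lim_1_over_n] by simp
        qed
        \<comment> \<open>Convergence in the function type is coordinatewise; this is applied once
          in \<open>i\<close> and once more in \<open>k\<close>.\<close>
        then have "(\<lambda>n. g n x k) \<longlonglongrightarrow> x k" for k
          using limitin_componentwise[of "\<lambda>_. euclidean" UNIV "\<lambda>n. g n x k" "x k" sequentially]
          by (simp add: euclidean_product_topology)
        then show ?thesis
          using limitin_componentwise[of "\<lambda>_. euclidean" UNIV "\<lambda>n. g n x" x sequentially]
          by (simp add: euclidean_product_topology)
      qed
      have lim: "(\<lambda>n. f (g n x)) \<longlonglongrightarrow> f x" if x: "x \<in> space (cube K d)" for x
        by (rule continuous_on_tendsto_compose[OF f(1) lim_g[OF x] x])
          (intro always_eventually allI in_cube x)
      have fg: "(\<lambda>x. f (g n x)) \<in> borel_measurable \<mu>" for n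
        by (rule measurable_compose[OF gmu]) simp
      \<comment> \<open>Measurability of \<open>f\<close> for the product sigma-algebra is obtained
        from continuity: \<open>f\<close> is the pointwise limit of the functions
        \<open>f (g n x)\<close>, which are measurable because \<open>g n\<close> takes values in a
        discrete space.\<close>
      have fmu: "f \<in> borel_measurable \<mu>"
      proof (rule borel_measurable_LIMSEQ_real)
        show "(\<lambda>n. f (g n x)) \<longlonglongrightarrow> f x" if "x \<in> space \<mu>" for x
          using lim that space_mu by blast
      qed (rule fg)
      then have fc: "f \<in> borel_measurable (cube K d)"
        using sets_mu by (simp cong: measurable_cong_sets)
      obtain B where B: "\<And>x. x \<in> space (cube K d) \<Longrightarrow> norm (f x) \<le> B"
        using f(2) by (auto simp: bounded_iff)
      have "(\<lambda>n. \<integral>x. f (g n x) \<partial>\<mu>) \<longlonglongrightarrow> (\<integral>x. f x \<partial>\<mu>)"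
      proof (rule integral_dominated_convergence[where w = "\<lambda>_. B"])
        show "AE x in \<mu>. (\<lambda>n. f (g n x)) \<longlonglongrightarrow> f x"
          by (rule AE_I2) (simp add: lim space_mu)
        show "AE x in \<mu>. norm (f (g n x)) \<le> B" for n
          using B in_cube unfolding space_mu[symmetric] by (intro AE_I2) blast
      qed (use fmu fg in auto)
      then show "(\<lambda>n. \<integral>x. f x \<partial>(distr \<mu> (cube K d) (g n))) \<longlonglongrightarrow> (\<integral>x. f x \<partial>\<mu>)"
        unfolding integral_distr[OF gmeas fc] .
    qed
  qed
qed

section \<open>Wasserstein distance and test functions\<close>

text \<open>Passes an estimate valid for every coupling to the infimum over couplings. A finite
  \<open>b\<close> can be subtracted; an infinite one makes the right side infinite.\<close>

lemma ennreal_le_add_INF: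
  fixes a b :: ennreal
  assumes "\<And>i. i \<in> I \<Longrightarrow> a \<le> b + c i"
  shows "a \<le> b + (INF i\<in>I. c i)"
proof (cases "b = top")
  case False
  then have "a - b \<le> (INF i\<in>I. c i)"
    using assms by (intro INF_greatest) (simp add: ennreal_minus_le_iff)
  with False show ?thesis by (simp add: ennreal_minus_le_iff)
qed simp

text \<open>The easy half of Kantorovich duality: integrate the Lipschitz bound against a coupling.
  It is written additively to avoid subtraction in \<open>ennreal\<close>. Both directions are
  stated because the estimate will always be the first argument of
  \<open>wasserstein\<close>.\<close>

lemma wasserstein_lipschitz:
  fixes f :: "'a \<Rightarrow> ennreal"
  assumes f: "f \<in> borel_measurable M"
    and \<delta>: "(\<lambda>z. \<delta> (fst z) (snd z)) \<in> borel_measurable (M \<Otimes>\<^sub>M M)"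
    and \<mu>: "sets \<mu> = sets M" and \<nu>: "sets \<nu> = sets M"
  shows "(\<And>x y. x \<in> space M \<Longrightarrow> y \<in> space M \<Longrightarrow> f x \<le> f y + ennreal (\<delta> x y)) \<Longrightarrow>
      (\<integral>\<^sup>+x. f x \<partial>\<mu>) \<le> (\<integral>\<^sup>+x. f x \<partial>\<nu>) + wasserstein \<delta> \<mu> \<nu>"
    and "(\<And>x y. x \<in> space M \<Longrightarrow> y \<in> space M \<Longrightarrow> f y \<le> f x + ennreal (\<delta> x y)) \<Longrightarrow>
      (\<integral>\<^sup>+x. f x \<partial>\<nu>) \<le> (\<integral>\<^sup>+x. f x \<partial>\<mu>) + wasserstein \<delta> \<mu> \<nu>"
proof -
  have coupling: "(\<integral>\<^sup>+z. f (fst z) \<partial>\<pi>) = (\<integral>\<^sup>+x. f x \<partial>\<mu>) \<and> (\<integral>\<^sup>+z. f (snd z) \<partial>\<pi>) = (\<integral>\<^sup>+x. f x \<partial>\<nu>) \<and>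
      sets \<pi> = sets (M \<Otimes>\<^sub>M M) \<and> space \<pi> = space M \<times> space M"
    if \<pi>: "\<pi> \<in> couplings \<mu> \<nu>" for \<pi>
  proof -
    have sp: "sets \<pi> = sets (\<mu> \<Otimes>\<^sub>M \<nu>)"
      and d: "distr \<pi> \<mu> fst = \<mu>" "distr \<pi> \<nu> snd = \<nu>"
      using \<pi> by (auto simp: couplings_def space_prob_algebra)
    have m: "fst \<in> \<pi> \<rightarrow>\<^sub>M \<mu>" "snd \<in> \<pi> \<rightarrow>\<^sub>M \<nu>"
      unfolding measurable_cong_sets[OF sp refl] by (rule measurable_fst measurable_snd)+
    have f': "f \<in> borel_measurable \<mu>" "f \<in> borel_measurable \<nu>"
      using f unfolding measurable_cong_sets[OF \<mu> refl] measurable_cong_sets[OF \<nu> refl] by auto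
    have "(\<integral>\<^sup>+x. f x \<partial>\<mu>) = (\<integral>\<^sup>+x. f x \<partial>(distr \<pi> \<mu> fst))" by (simp add: d)
    also have "\<dots> = (\<integral>\<^sup>+z. f (fst z) \<partial>\<pi>)" by (rule nn_integral_distr[OF m(1)]) (use f' in auto)
    finally have 1: "(\<integral>\<^sup>+z. f (fst z) \<partial>\<pi>) = (\<integral>\<^sup>+x. f x \<partial>\<mu>)" ..
    have "(\<integral>\<^sup>+x. f x \<partial>\<nu>) = (\<integral>\<^sup>+x. f x \<partial>(distr \<pi> \<nu> snd))" by (simp add: d)
    also have "\<dots> = (\<integral>\<^sup>+z. f (snd z) \<partial>\<pi>)" by (rule nn_integral_distr[OF m(2)]) (use f' in auto)
    finally have 2: "(\<integral>\<^sup>+z. f (snd z) \<partial>\<pi>) = (\<integral>\<^sup>+x. f x \<partial>\<nu>)" ..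
    have s: "sets \<pi> = sets (M \<Otimes>\<^sub>M M)"
      using sp sets_pair_measure_cong[OF \<mu> \<nu>] by simp
    then show ?thesis
      using 1 2 sets_eq_imp_space_eq[OF s] by (simp add: space_pair_measure)
  qed
  have meas: "(\<lambda>z. ennreal (\<delta> (fst z) (snd z))) \<in> borel_measurable \<pi> \<and>
      (\<lambda>z. f (fst z)) \<in> borel_measurable \<pi> \<and> (\<lambda>z. f (snd z)) \<in> borel_measurable \<pi>"
    if s: "sets \<pi> = sets (M \<Otimes>\<^sub>M M)" for \<pi> :: "('a \<times> 'a) measure"
    unfolding measurable_cong_sets[OF s refl]
    using \<delta> measurable_compose[OF measurable_fst f] measurable_compose[OF measurable_snd f] by auto
  show "(\<integral>\<^sup>+x. f x \<partial>\<mu>) \<le> (\<integral>\<^sup>+x. f x \<partial>\<nu>) + wasserstein \<delta> \<mu> \<nu>"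
    if lip: "\<And>x y. x \<in> space M \<Longrightarrow> y \<in> space M \<Longrightarrow> f x \<le> f y + ennreal (\<delta> x y)"
    unfolding wasserstein_def
  proof (rule ennreal_le_add_INF)
    fix \<pi> assume "\<pi> \<in> couplings \<mu> \<nu>"
    note c = coupling[OF this]
    have "(\<integral>\<^sup>+z. f (fst z) \<partial>\<pi>) \<le> (\<integral>\<^sup>+z. f (snd z) + ennreal (\<delta> (fst z) (snd z)) \<partial>\<pi>)"
      using c by (intro nn_integral_mono lip) auto
    also have "\<dots> = (\<integral>\<^sup>+z. f (snd z) \<partial>\<pi>) + (\<integral>\<^sup>+z. ennreal (\<delta> (fst z) (snd z)) \<partial>\<pi>)"
      using c meas[of \<pi>] by (intro nn_integral_add) auto
    finally show "(\<integral>\<^sup>+x. f x \<partial>\<mu>) \<le> (\<integral>\<^sup>+x. f x \<partial>\<nu>) + (\<integral>\<^sup>+z. ennreal (\<delta> (fst z) (snd z)) \<partial>\<pi>)"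
      using c by simp
  qed
  show "(\<integral>\<^sup>+x. f x \<partial>\<nu>) \<le> (\<integral>\<^sup>+x. f x \<partial>\<mu>) + wasserstein \<delta> \<mu> \<nu>"
    if lip: "\<And>x y. x \<in> space M \<Longrightarrow> y \<in> space M \<Longrightarrow> f y \<le> f x + ennreal (\<delta> x y)"
    unfolding wasserstein_def
  proof (rule ennreal_le_add_INF)
    fix \<pi> assume "\<pi> \<in> couplings \<mu> \<nu>"
    note c = coupling[OF this]
    have "(\<integral>\<^sup>+z. f (snd z) \<partial>\<pi>) \<le> (\<integral>\<^sup>+z. f (fst z) + ennreal (\<delta> (fst z) (snd z)) \<partial>\<pi>)"
      using c by (intro nn_integral_mono lip) auto
    also have "\<dots> = (\<integral>\<^sup>+z. f (fst z) \<partial>\<pi>) + (\<integral>\<^sup>+z. ennreal (\<delta> (fst z) (snd z)) \<partial>\<pi>)"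
      using c meas[of \<pi>] by (intro nn_integral_add) auto
    finally show "(\<integral>\<^sup>+x. f x \<partial>\<nu>) \<le> (\<integral>\<^sup>+x. f x \<partial>\<mu>) + (\<integral>\<^sup>+z. ennreal (\<delta> (fst z) (snd z)) \<partial>\<pi>)"
      using c by simp
  qed
qed

section \<open>Uniform distributions on finitely many points: samples and separation\<close>

definition uniform_points :: "'a measure \<Rightarrow> nat \<Rightarrow> (nat \<Rightarrow> 'a) \<Rightarrow> 'a measure" where
  "uniform_points M m u = distr (uniform_count_measure {..<m}) M u"

lemma measurable_uniform_count_measure_iff:
  "u \<in> uniform_count_measure A \<rightarrow>\<^sub>M M \<longleftrightarrow> u \<in> A \<rightarrow> space M"
  by (subst measurable_cong_sets[OF _ refl, of _ "count_space A"])
    (auto simp: sets_uniform_count_measure)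

lemma sets_uniform_points [simp]: "sets (uniform_points M m u) = sets M"
  by (simp add: uniform_points_def)

lemma prob_space_uniform_points:
  assumes "m > 0" "u \<in> {..<m} \<rightarrow> space M"
  shows "prob_space (uniform_points M m u)"
  unfolding uniform_points_def
  using assms by (intro prob_space.prob_space_distr prob_space_uniform_count_measure)
    (auto simp: measurable_uniform_count_measure_iff)

lemma nn_integral_uniform_points:
  assumes "m > 0" "u \<in> {..<m} \<rightarrow> space M" "f \<in> borel_measurable M"
  shows "(\<integral>\<^sup>+x. f x \<partial>(uniform_points M m u)) = (\<Sum>j<m. f (u j)) / of_nat m"
  unfolding uniform_points_def
  using assms by (subst nn_integral_distr)
    (auto simp: measurable_uniform_count_measure_iff uniform_count_measure_def
      nn_integral_point_measure_finite divide_ennreal_def sum_distrib_left mult.commute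
      inverse_eq_divide
      ennreal_of_nat_eq_real_of_nat inverse_ennreal)

text \<open>Only an inequality, since several indices may name the same point.\<close>

lemma emeasure_uniform_points_atom:
  assumes "u \<in> {..<m} \<rightarrow> space M" "j < m" "{u j} \<in> sets M"
  shows "emeasure (uniform_points M m u) {u j} \<ge> 1 / of_nat m"
proof -
  have "1 / of_nat m = emeasure (uniform_count_measure {..<m}) {j}"
    using assms by (simp add: emeasure_uniform_count_measure ennreal_of_nat_eq_real_of_nat
        divide_ennreal flip: ennreal_1)
  also have "\<dots> \<le> emeasure (uniform_count_measure {..<m}) (u -` {u j} \<inter> space (uniform_count_measure {..<m}))"
    using assms by (intro emeasure_mono) (auto simp: space_uniform_count_measure sets_uniform_count_measure)
  also have "\<dots> = emeasure (uniform_points M m u) {u j}"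
    unfolding uniform_points_def
    using assms by (subst emeasure_distr) (auto simp: measurable_uniform_count_measure_iff)
  finally show ?thesis .
qed

text \<open>The sum over the atoms is the integral of a measurable function below \<open>g\<close>.
  As \<open>g\<close> itself is arbitrary, this applies directly to the loss as a function of the
  sample.\<close>

lemma nn_integral_ge_atoms:
  assumes "finite A" "\<And>a. a \<in> A \<Longrightarrow> {a} \<in> sets M"
  shows "(\<Sum>a\<in>A. g a * emeasure M {a}) \<le> (\<integral>\<^sup>+x. g x \<partial>M)"
proof -
  have "(\<Sum>a\<in>A. g a * emeasure M {a}) = (\<Sum>a\<in>A. \<integral>\<^sup>+x. g a * indicator {a} x \<partial>M)"
    using assms by (intro sum.cong) (simp_all add: nn_integral_cmult_indicator)
  also have "\<dots> = (\<integral>\<^sup>+x. (\<Sum>a\<in>A. g a * indicator {a} x) \<partial>M)"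
    using assms by (intro nn_integral_sum[symmetric]) auto
  also have "\<dots> \<le> (\<integral>\<^sup>+x. g x \<partial>M)"
  proof (rule nn_integral_mono)
    fix x
    have "(\<Sum>a\<in>A. g a * indicator {a} x) = (\<Sum>a\<in>A. if x = a then g a else 0)"
      by (intro sum.cong) (auto simp: indicator_def)
    also have "\<dots> \<le> g x" using assms(1) by (simp add: sum.delta)
    finally show "(\<Sum>a\<in>A. g a * indicator {a} x) \<le> g x" .
  qed
  finally show ?thesis .
qed

text \<open>A sample is recorded by the tuple \<open>J\<close> of drawn indices. Its atom is a box,
  so it has mass at least \<open>(1 / m) ^ n\<close>, and injectivity of \<open>u\<close> ensures
  that different tuples give different atoms.\<close>

lemma sample_nn_integral_ge:
  assumes m: "m > 0" and u: "u \<in> {..<m} \<rightarrow> space M" "inj_on u {..<m}"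
    and sing: "\<And>x. x \<in> space M \<Longrightarrow> {x} \<in> sets M"
  shows "(\<Sum>J\<in>PiE {1..n} (\<lambda>_. {..<m}). g (\<lambda>i\<in>{1..n}. u (J i))) * (1 / of_nat m) ^ n
    \<le> (\<integral>\<^sup>+x. g x \<partial>(PiM {1..n} (\<lambda>_. uniform_points M m u)))"
proof -
  let ?U = "uniform_points M m u" and ?P = "PiE {1..n} (\<lambda>_. {..<m})"
  let ?x = "\<lambda>J. \<lambda>i\<in>{1..n}. u (J i)"
  interpret U: prob_space ?U by (rule prob_space_uniform_points[OF m u(1)])
  interpret P: product_sigma_finite "\<lambda>_::nat. ?U" ..
  have uJ: "u (J i) \<in> space M" "J i < m" if "J \<in> ?P" "i \<in> {1..n}" for J i
    using u(1) that by (auto simp: PiE_iff)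
  have box: "{?x J} = PiE {1..n} (\<lambda>i. {u (J i)})" for J
  proof -
    have "PiE {1..n} (\<lambda>i. {u (J i)}) = PiE {1..n} (\<lambda>i. {?x J i})"
      by (intro PiE_cong) simp
    also have "\<dots> = {?x J}"
      by (rule PiE_singleton) (rule restrict_extensional)
    finally show ?thesis ..
  qed
  have atom: "(1 / of_nat m) ^ n \<le> emeasure (PiM {1..n} (\<lambda>_. ?U)) {?x J}" if J: "J \<in> ?P" for J
  proof -
    have "(1 / of_nat m) ^ n = (\<Prod>i\<in>{1..n}. (1 / of_nat m :: ennreal))" by simp
    also have "\<dots> \<le> (\<Prod>i\<in>{1..n}. emeasure ?U {u (J i)})"
      using uJ[OF J] by (intro prod_mono_ennreal emeasure_uniform_points_atom u sing) auto
    also have "\<dots> = emeasure (PiM {1..n} (\<lambda>_. ?U)) {?x J}"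
      unfolding box using uJ[OF J] by (subst P.emeasure_PiM) (auto intro: sing)
    finally show ?thesis .
  qed
  have inj: "inj_on ?x ?P"
  proof (rule inj_onI)
    fix J J' assume J: "J \<in> ?P" "J' \<in> ?P" and eq: "?x J = ?x J'"
    show "J = J'"
    proof (rule PiE_ext[OF J])
      fix i assume i: "i \<in> {1..n}"
      have "u (J i) = u (J' i)" using fun_cong[OF eq, of i] i by simp
      then show "J i = J' i" using uJ J i u(2) by (auto dest: inj_onD)
    qed
  qed
  have fin: "finite ?P" by (intro finite_PiE) auto
  have "(\<Sum>J\<in>?P. g (?x J)) * (1 / of_nat m) ^ n = (\<Sum>J\<in>?P. g (?x J) * (1 / of_nat m) ^ n)"
    by (rule sum_distrib_right)
  also have "\<dots> \<le> (\<Sum>J\<in>?P. g (?x J) * emeasure (PiM {1..n} (\<lambda>_. ?U)) {?x J})"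
    by (intro sum_mono mult_left_mono atom) auto
  also have "\<dots> = (\<Sum>a\<in>?x ` ?P. g a * emeasure (PiM {1..n} (\<lambda>_. ?U)) {a})"
    by (subst sum.reindex[OF inj]) (simp only: o_def)
  also have "\<dots> \<le> (\<integral>\<^sup>+x. g x \<partial>(PiM {1..n} (\<lambda>_. ?U)))"
  proof (rule nn_integral_ge_atoms)
    show "finite (?x ` ?P)" using fin by simp
    fix a assume "a \<in> ?x ` ?P"
    then obtain J where J: "J \<in> ?P" "a = ?x J" by blast
    show "{a} \<in> sets (PiM {1..n} (\<lambda>_. ?U))"
      unfolding J(2) box using uJ[OF J(1)] by (intro sets_PiM_I_finite) (auto intro: sing)
  qed
  finally show ?thesis .
qed

text \<open>The truncated distance to the points at which \<open>u\<close> differs from \<open>v\<close> separates the two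
  uniform distributions.\<close>

lemma wasserstein_two_points:
  fixes \<delta> :: "'a \<Rightarrow> 'a \<Rightarrow> real" and \<epsilon> :: real
  assumes tri: "\<And>x y z. \<delta> x z \<le> \<delta> x y + \<delta> y z" and sym: "\<And>x y. \<delta> x y = \<delta> y x"
    and refl: "\<And>x. \<delta> x x = 0"
    and meas: "(\<lambda>z. \<delta> (fst z) (snd z)) \<in> borel_measurable (M \<Otimes>\<^sub>M M)"
    and u: "u \<in> {..<m} \<rightarrow> space M" and v: "v \<in> {..<m} \<rightarrow> space M"
    and T: "T \<subseteq> {..<m}" "T \<noteq> {}"
    and sep: "\<And>i j. i < m \<Longrightarrow> j \<in> T \<Longrightarrow> \<epsilon> \<le> \<delta> (v i) (u j)" and eps: "\<epsilon> \<ge> 0"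
    and \<nu>: "sets \<nu> = sets M"
  shows "ennreal (\<epsilon> * card T / m) \<le>
    wasserstein \<delta> \<nu> (uniform_points M m u) + wasserstein \<delta> \<nu> (uniform_points M m v)"
proof -
  \<comment> \<open>This test function is 1-Lipschitz, at most \<epsilon> everywhere, at least
    \<epsilon> at all points of \<open>v\<close>, and zero at \<open>u j\<close> for
    \<open>j \<in> T\<close>. Its two integrals therefore differ by at least
    \<open>\<epsilon> * card T / m\<close>.\<close>
  define f where "f x = (INF j\<in>T. ennreal (min \<epsilon> (\<delta> x (u j))))" for x
  have fin: "finite T" using T finite_subset by blast
  have m: "m > 0" using T by auto
  have uT: "u j \<in> space M" if "j \<in> T" for j using that u T by auto
  have pos: "0 \<le> \<delta> x y" for x y
    using tri[of x x y] sym[of x y] refl[of x] by simp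
  have f_meas: "f \<in> borel_measurable M"
    unfolding f_def
  proof (rule borel_measurable_INF)
    fix j assume j: "j \<in> T"
    have "(\<lambda>x. (x, u j)) \<in> M \<rightarrow>\<^sub>M M \<Otimes>\<^sub>M M" using uT[OF j] by simp
    from measurable_compose[OF this meas] have "(\<lambda>x. \<delta> x (u j)) \<in> borel_measurable M" by simp
    then show "(\<lambda>x. ennreal (min \<epsilon> (\<delta> x (u j)))) \<in> borel_measurable M" by simp
  qed (use fin in \<open>auto intro: countable_finite\<close>)
  have lip: "f x \<le> f y + ennreal (\<delta> x y)" for x y
  proof -
    have "f x \<le> ennreal (\<delta> x y) + f y"
      unfolding f_def[of y]
    proof (rule ennreal_le_add_INF)
      fix j assume j: "j \<in> T"
      have "f x \<le> ennreal (min \<epsilon> (\<delta> x (u j)))" unfolding f_def using j by (rule INF_lower)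
      also have "\<dots> \<le> ennreal (\<delta> x y + min \<epsilon> (\<delta> y (u j)))"
        using tri[of x "u j" y] pos[of x y] by (intro ennreal_leI) auto
      also have "\<dots> = ennreal (\<delta> x y) + ennreal (min \<epsilon> (\<delta> y (u j)))"
        using pos eps by (intro ennreal_plus) auto
      finally show "f x \<le> ennreal (\<delta> x y) + ennreal (min \<epsilon> (\<delta> y (u j)))" .
    qed
    then show ?thesis by (simp add: add.commute)
  qed
  have lip_sym: "f y \<le> f x + ennreal (\<delta> x y)" for x y
    using lip[of y x] sym[of y x] by simp
  have f_zero: "f (u j) = 0" if j: "j \<in> T" for j
  proof -
    have "f (u j) \<le> ennreal (min \<epsilon> (\<delta> (u j) (u j)))" unfolding f_def using j by (rule INF_lower)
    then show ?thesis using refl eps by simp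
  qed
  have f_le: "f x \<le> ennreal \<epsilon>" for x
  proof -
    obtain j where "j \<in> T" using T by blast
    then have "f x \<le> ennreal (min \<epsilon> (\<delta> x (u j)))" unfolding f_def by (rule INF_lower)
    also have "\<dots> \<le> ennreal \<epsilon>" by (intro ennreal_leI) simp
    finally show ?thesis .
  qed
  have f_v: "f (v i) \<ge> ennreal \<epsilon>" if "i < m" for i
    unfolding f_def using sep[OF that] by (intro INF_greatest) (simp add: min_absorb1)
  let ?U = "uniform_points M m u" and ?V = "uniform_points M m v"
  have int_u: "(\<integral>\<^sup>+x. f x \<partial>?U) \<le> ennreal (\<epsilon> * (real m - card T) / m)"
  proof -
    have "(\<Sum>j<m. f (u j)) = (\<Sum>j\<in>{..<m} - T. f (u j)) + (\<Sum>j\<in>T. f (u j))"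
      using T by (intro sum.subset_diff) auto
    also have "\<dots> \<le> (\<Sum>j\<in>{..<m} - T. ennreal \<epsilon>) + (\<Sum>j\<in>T. 0)"
      by (intro add_mono sum_mono f_le) (simp add: f_zero)
    also have "\<dots> = ennreal (\<epsilon> * (real m - card T))"
      using T fin eps card_mono[of "{..<m}" T]
      by (simp add: card_Diff_subset of_nat_diff ennreal_mult ennreal_of_nat_eq_real_of_nat mult.commute)
    finally have "(\<Sum>j<m. f (u j)) / of_nat m \<le> ennreal (\<epsilon> * (real m - card T)) / of_nat m"
      by (rule divide_right_mono_ennreal)
    also have "\<dots> = ennreal (\<epsilon> * (real m - card T) / m)"
      using T fin eps m card_mono[of "{..<m}" T]
      by (simp add: ennreal_of_nat_eq_real_of_nat divide_ennreal)
    finally show ?thesis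
      by (simp add: nn_integral_uniform_points[OF m u f_meas])
  qed
  have int_v: "ennreal \<epsilon> \<le> (\<integral>\<^sup>+x. f x \<partial>?V)"
  proof -
    have "ennreal \<epsilon> = (\<Sum>j<m. ennreal \<epsilon>) / of_nat m"
      using m eps by (simp add: ennreal_of_nat_eq_real_of_nat divide_ennreal flip: ennreal_mult)
    also have "\<dots> \<le> (\<Sum>j<m. f (v j)) / of_nat m"
      by (intro divide_right_mono_ennreal sum_mono f_v) simp
    finally show ?thesis
      by (simp add: nn_integral_uniform_points[OF m v f_meas])
  qed
  \<comment> \<open>\<epsilon> is split into the bound for the integral under \<open>?U\<close>,
    which is finite and cancelled at the end, and the claimed separation.\<close>
  have "ennreal (\<epsilon> * (real m - card T) / m) + ennreal (\<epsilon> * card T / m) = ennreal \<epsilon>"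
    using eps m T fin card_mono[of "{..<m}" T]
    by (subst ennreal_plus[symmetric]) (auto simp: field_simps intro: mult_left_mono)
  also have "\<dots> \<le> (\<integral>\<^sup>+x. f x \<partial>?V)" by (rule int_v)
  also have "\<dots> \<le> (\<integral>\<^sup>+x. f x \<partial>\<nu>) + wasserstein \<delta> \<nu> ?V"
    by (intro wasserstein_lipschitz(2)[OF f_meas meas \<nu>] lip_sym) simp
  also have "\<dots> \<le> ((\<integral>\<^sup>+x. f x \<partial>?U) + wasserstein \<delta> \<nu> ?U) + wasserstein \<delta> \<nu> ?V"
    using lip by (intro add_right_mono wasserstein_lipschitz(1)[OF f_meas meas \<nu>]) auto
  also have "\<dots> \<le> ennreal (\<epsilon> * (real m - card T) / m) + (wasserstein \<delta> \<nu> ?U + wasserstein \<delta> \<nu> ?V)"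
    using int_u by (simp add: add.assoc add_right_mono)
  finally show ?thesis
    by (simp add: ennreal_add_left_cancel_le)
qed

section \<open>Flipping unobserved choices\<close>

text \<open>The points \<open>h j\<close> and \<open>h (j + m)\<close> form the pair with number
  \<open>j\<close>. Encoding a choice by the set of pairs that contribute their first point turns
  the hypotheses into \<open>Pow {..<m}\<close> and flipping into a symmetric difference.\<close>

definition signed_points :: "nat \<Rightarrow> (nat \<Rightarrow> 'a) \<Rightarrow> nat set \<Rightarrow> nat \<Rightarrow> 'a" where
  "signed_points m h \<sigma> j = h (if j \<in> \<sigma> then j else j + m)"

text \<open>The sample \<open>J\<close> is not affected by flipping \<open>\<sigma>\<close> on the set of at least \<open>n\<close> unobserved indices,
  which is an involution of the hypotheses; hence no estimator is close to both.\<close>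

lemma average_risk_lower_bound:
  fixes \<delta> :: "'a \<Rightarrow> 'a \<Rightarrow> real" and n :: nat and \<epsilon> :: real
  defines "m \<equiv> 2 * n"
  assumes n: "n > 0"
    and tri: "\<And>x y z. \<delta> x z \<le> \<delta> x y + \<delta> y z" and sym: "\<And>x y. \<delta> x y = \<delta> y x"
    and refl: "\<And>x. \<delta> x x = 0"
    and meas: "(\<lambda>z. \<delta> (fst z) (snd z)) \<in> borel_measurable (M \<Otimes>\<^sub>M M)"
    and sing: "\<And>x. x \<in> space M \<Longrightarrow> {x} \<in> sets M"
    and h: "h \<in> {..<2 * m} \<rightarrow> space M"
    and sep: "\<And>i j. i < 2 * m \<Longrightarrow> j < 2 * m \<Longrightarrow> i \<noteq> j \<Longrightarrow> \<epsilon> \<le> \<delta> (h i) (h j)" and eps: "\<epsilon> > 0"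
    and E: "E \<in> PiM {1..n} (\<lambda>_. M) \<rightarrow>\<^sub>M prob_algebra M"
  shows "2 ^ m * ennreal (\<epsilon> / 2) \<le> 2 * (\<Sum>\<sigma>\<in>Pow {..<m}.
    \<integral>\<^sup>+x. wasserstein \<delta> (E x) (uniform_points M m (signed_points m h \<sigma>))
      \<partial>(PiM {1..n} (\<lambda>_. uniform_points M m (signed_points m h \<sigma>))))"
proof -
  let ?s = "signed_points m h" and ?P = "PiE {1..n} (\<lambda>_. {..<m})"
  let ?x = "\<lambda>\<sigma> J. \<lambda>i\<in>{1..n}. ?s \<sigma> (J i)"
  let ?W = "\<lambda>\<sigma> J. wasserstein \<delta> (E (?x \<sigma> J)) (uniform_points M m (?s \<sigma>))"
  have m: "m > 0" using n by (simp add: m_def)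
  have h_inj: "inj_on h {..<2 * m}"
  proof (rule inj_onI, rule ccontr)
    fix i j assume "i \<in> {..<2 * m}" "j \<in> {..<2 * m}" "h i = h j" "i \<noteq> j"
    then show False using sep[of i j] eps refl[of "h j"] by simp
  qed
  have s: "?s \<sigma> \<in> {..<m} \<rightarrow> space M" for \<sigma>
    using h by (auto simp: signed_points_def Pi_iff)
  have s_inj: "inj_on (?s \<sigma>) {..<m}" for \<sigma>
    by (rule inj_onI) (auto simp: signed_points_def split: if_splits dest: inj_onD[OF h_inj])
  have observed: "2 ^ m * ennreal (\<epsilon> / 2) \<le> 2 * (\<Sum>\<sigma>\<in>Pow {..<m}. ?W \<sigma> J)" if J: "J \<in> ?P" for J
  proof -
    \<comment> \<open>Of the \<open>m = 2 * n\<close> pairs at most \<open>n\<close> are observed,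
      so \<open>card T / m\<close> is at least 1/2; this is the source of
      \<open>\<epsilon> / 2\<close>.\<close>
    define T where "T = {..<m} - J ` {1..n}"
    define \<phi> where "\<phi> \<sigma> = (\<sigma> - T) \<union> (T - \<sigma>)" for \<sigma>
    have T: "T \<subseteq> {..<m}" by (auto simp: T_def)
    have "J ` {1..n} \<subseteq> {..<m}" using J by (auto simp: PiE_iff)
    then have "card T = m - card (J ` {1..n})"
      by (simp add: T_def card_Diff_subset)
    moreover have "card (J ` {1..n}) \<le> n" using card_image_le[of "{1..n}" J] by simp
    ultimately have cardT: "card T \<ge> n" by (simp add: m_def)
    then have "T \<noteq> {}" using n by auto
    have bij: "bij_betw \<phi> (Pow {..<m}) (Pow {..<m})"
      by (rule bij_betwI[where g = \<phi>]) (use T in \<open>auto simp: \<phi>_def\<close>)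
    have x_eq: "?x (\<phi> \<sigma>) J = ?x \<sigma> J" for \<sigma>
      by (auto simp: signed_points_def \<phi>_def T_def fun_eq_iff restrict_def)
    have flip: "ennreal (\<epsilon> / 2) \<le> ?W \<sigma> J + ?W (\<phi> \<sigma>) J" for \<sigma>
    proof -
      have "?x \<sigma> J \<in> space (PiM {1..n} (\<lambda>_. M))"
        using J s by (auto simp: space_PiM PiE_iff Pi_iff)
      then have E\<sigma>: "sets (E (?x \<sigma> J)) = sets M"
        using measurable_space[OF E] by (simp add: space_prob_algebra)
      have "\<epsilon> * real n \<le> \<epsilon> * real (card T)" using cardT eps by simp
      then have "ennreal (\<epsilon> / 2) \<le> ennreal (\<epsilon> * card T / m)"
        using n by (intro ennreal_leI) (simp add: m_def field_simps)
      also have "\<dots> \<le> wasserstein \<delta> (E (?x \<sigma> J)) (uniform_points M m (?s \<sigma>)) +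
          wasserstein \<delta> (E (?x \<sigma> J)) (uniform_points M m (?s (\<phi> \<sigma>)))"
      proof (rule wasserstein_two_points[OF tri sym refl meas s s T \<open>T \<noteq> {}\<close> _ _ E\<sigma>])
        fix i j assume ij: "i < m" "j \<in> T"
        \<comment> \<open>For \<open>i \<noteq> j\<close> the two indices differ modulo
          \<open>m\<close>. For \<open>i = j \<in> T\<close> the flip selects the other point of the
          pair.\<close>
        then have "(if i \<in> \<phi> \<sigma> then i else i + m) \<noteq> (if j \<in> \<sigma> then j else j + m)"
          using T by (auto simp: \<phi>_def)
        then show "\<epsilon> \<le> \<delta> (?s (\<phi> \<sigma>) i) (?s \<sigma> j)"
          unfolding signed_points_def using ij T by (intro sep) auto
      qed (use eps in auto)
      finally show ?thesis unfolding x_eq .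
    qed
    have "2 ^ m * ennreal (\<epsilon> / 2) = (\<Sum>\<sigma>\<in>Pow {..<m}. ennreal (\<epsilon> / 2))"
      by (simp add: card_Pow)
    also have "\<dots> \<le> (\<Sum>\<sigma>\<in>Pow {..<m}. ?W \<sigma> J + ?W (\<phi> \<sigma>) J)"
      by (intro sum_mono flip)
    also have "\<dots> = (\<Sum>\<sigma>\<in>Pow {..<m}. ?W \<sigma> J) + (\<Sum>\<sigma>\<in>Pow {..<m}. ?W (\<phi> \<sigma>) J)"
      by (rule sum.distrib)
    \<comment> \<open>The flip permutes the hypotheses, so the sum over flipped hypotheses is the
      same sum; hence the factor 2.\<close>
    also have "(\<Sum>\<sigma>\<in>Pow {..<m}. ?W (\<phi> \<sigma>) J) = (\<Sum>\<sigma>\<in>Pow {..<m}. ?W \<sigma> J)"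
      by (rule sum.reindex_bij_betw[OF bij])
    finally show ?thesis unfolding mult_2 .
  qed
  \<comment> \<open>The \<open>m ^ n\<close> index tuples, each weighted by
    \<open>(1 / m) ^ n\<close>, have total weight 1, so the bound for fixed \<open>J\<close> can be
    averaged over \<open>J\<close>.\<close>
  have unit: "of_nat m ^ n * (1 / of_nat m :: ennreal) ^ n = 1"
    using m by (simp add: ennreal_times_divide ennreal_divide_self of_nat_less_top flip: power_mult_distrib)
  have "2 ^ m * ennreal (\<epsilon> / 2) = 2 ^ m * ennreal (\<epsilon> / 2) * (of_nat m ^ n * (1 / of_nat m) ^ n)"
    unfolding unit by simp
  also have "\<dots> = (\<Sum>J\<in>?P. 2 ^ m * ennreal (\<epsilon> / 2)) * (1 / of_nat m) ^ n"
    by (simp add: card_PiE mult_ac)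
  also have "\<dots> \<le> (\<Sum>J\<in>?P. 2 * (\<Sum>\<sigma>\<in>Pow {..<m}. ?W \<sigma> J)) * (1 / of_nat m) ^ n"
    by (intro mult_right_mono sum_mono observed) auto
  also have "\<dots> = 2 * (\<Sum>\<sigma>\<in>Pow {..<m}. (\<Sum>J\<in>?P. ?W \<sigma> J) * (1 / of_nat m) ^ n)"
    unfolding sum_distrib_left[symmetric] sum_distrib_right[symmetric] mult.assoc
    by (subst sum.swap) (rule HOL.refl)
  also have "\<dots> \<le> 2 * (\<Sum>\<sigma>\<in>Pow {..<m}.
    \<integral>\<^sup>+x. wasserstein \<delta> (E x) (uniform_points M m (?s \<sigma>))
      \<partial>(PiM {1..n} (\<lambda>_. uniform_points M m (?s \<sigma>))))"
    by (intro mult_left_mono sum_mono sample_nn_integral_ge m s s_inj sing) auto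
  finally show ?thesis .
qed

section \<open>The sup-norm distance on the cube\<close>

text \<open>The index pair in the hypotheses ensures that \<open>Max\<close> is taken over a
  nonempty set.\<close>

lemma sup_dist_le_iff:
  assumes "k\<^sub>0 \<in> {1..K}" "i\<^sub>0 \<in> {1..d k\<^sub>0}"
  shows "sup_dist K d x y \<le> c \<longleftrightarrow> (\<forall>k\<in>{1..K}. \<forall>i\<in>{1..d k}. \<bar>x k i - y k i\<bar> \<le> c)"
proof -
  have "(k\<^sub>0, i\<^sub>0) \<in> (SIGMA k:{1..K}. {1..d k})" using assms by simp
  then have "(SIGMA k:{1..K}. {1..d k}) \<noteq> {}" by blast
  then show ?thesis unfolding sup_dist_def by (subst Max_le_iff) auto
qed

lemma sup_dist_ge:
  assumes "k \<in> {1..K}" "i \<in> {1..d k}"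
  shows "\<bar>x k i - y k i\<bar> \<le> sup_dist K d x y"
  using sup_dist_le_iff[where d = d, OF assms, of x y "sup_dist K d x y"] assms by blast

lemma sup_dist_sym: "sup_dist K d x y = sup_dist K d y x"
  unfolding sup_dist_def by (simp add: abs_minus_commute)

lemma sup_dist_triangle:
  assumes "k\<^sub>0 \<in> {1..K}" "i\<^sub>0 \<in> {1..d k\<^sub>0}"
  shows "sup_dist K d x z \<le> sup_dist K d x y + sup_dist K d y z"
  unfolding sup_dist_le_iff[where d = d, OF assms]
proof (intro ballI)
  fix k i assume ki: "k \<in> {1..K}" "i \<in> {1..d k}"
  show "\<bar>x k i - z k i\<bar> \<le> sup_dist K d x y + sup_dist K d y z"
    using sup_dist_ge[where d = d, OF ki, of x y] sup_dist_ge[where d = d, OF ki, of y z] by linarith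
qed

lemma sup_dist_refl:
  assumes "k\<^sub>0 \<in> {1..K}" "i\<^sub>0 \<in> {1..d k\<^sub>0}"
  shows "sup_dist K d x x = 0"
proof (rule antisym)
  show "sup_dist K d x x \<le> 0" by (simp add: sup_dist_le_iff[where d = d, OF assms])
  show "0 \<le> sup_dist K d x x" using sup_dist_ge[where d = d, OF assms, of x x] by simp
qed

lemma sup_dist_measurable:
  "(\<lambda>z. sup_dist K d (fst z) (snd z)) \<in> borel_measurable (cube K d \<Otimes>\<^sub>M cube K d)"
proof -
  have "(\<lambda>z. Max ((\<lambda>p. case p of (k, i) \<Rightarrow> \<bar>fst z k i - snd z k i\<bar>) ` (SIGMA k:{1..K}. {1..d k})))
    \<in> borel_measurable (cube K d \<Otimes>\<^sub>M cube K d)"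
  proof (rule borel_measurable_Max)
    fix p assume "p \<in> (SIGMA k:{1..K}. {1..d k})"
    then obtain k i where p: "p = (k, i)" and ki: "k \<in> {1..K}" "i \<in> {1..d k}" by auto
    note c = coordinate_measurable[where d = d, OF ki]
    note [measurable] = measurable_compose[OF measurable_fst c] measurable_compose[OF measurable_snd c]
    show "(\<lambda>z. case p of (k, i) \<Rightarrow> \<bar>fst z k i - snd z k i\<bar>) \<in> borel_measurable (cube K d \<Otimes>\<^sub>M cube K d)"
      unfolding p prod.case by measurable
  qed auto
  then show ?thesis unfolding sup_dist_def .
qed

section \<open>The minimax lower bound\<close>

text \<open>The supremum dominates the average risk over the \<open>2 ^ (2 * n)\<close> choices, all
  of which lie in \<open>P_CI\<close> because they are supported on perturbed grid points.\<close>

lemma minimax_lower_bound: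
  fixes M n :: nat
  assumes K: "K \<ge> 1" and d: "\<And>k. k \<in> {1..K} \<Longrightarrow> d k \<ge> 1"
    and n: "n > 0" and M: "M \<ge> 1" "4 * n \<le> M ^ (\<Sum>k=1..K. d k)"
    and E: "E \<in> PiM {1..n} (\<lambda>_. cube K d) \<rightarrow>\<^sub>M prob_algebra (cube K d)"
  shows "ennreal (1 / (8 * M)) \<le> (SUP \<mu> \<in> P_CI K d.
    \<integral>\<^sup>+ x. wasserstein (sup_dist K d) (E x) \<mu> \<partial>(PiM {1..n} (\<lambda>_. \<mu>)))"
    (is "_ \<le> ?S")
proof -
  \<comment> \<open>\<open>?\<epsilon>\<close> is the separation of the perturbed grid, and
    \<open>?m\<close> counts the pairs, so \<open>2 * ?m = 4 * n\<close> grid points are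
    used.\<close>
  let ?Q = "grid_index K d M" and ?m = "2 * n" and ?\<epsilon> = "1 / (2 * real M)"
  obtain p where p: "p \<in> ?Q \<rightarrow> space (cube K d)"
    "\<And>q k i. q \<in> ?Q \<Longrightarrow> k \<in> {1..K} \<Longrightarrow> i \<in> {1..d k} \<Longrightarrow>
      real (q k i) / M \<le> p q k i \<and> p q k i \<le> (real (q k i) + 1/2) / M"
    "\<And>k. k \<in> {1..K} \<Longrightarrow> inj_on (\<lambda>x. x k) (p ` ?Q)"
    by (rule grid_points_exist[OF M(1) d]) blast+
  obtain e where "bij_betw e {0..<card ?Q} ?Q"
    using ex_bij_betw_nat_finite[OF finite_grid_index] by blast
  then have e: "inj_on e {..<2 * ?m}" "e \<in> {..<2 * ?m} \<rightarrow> ?Q"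
    using M(2) by (auto simp: bij_betw_def card_grid_index intro: inj_on_subset)
  define h where "h = p \<circ> e"
  have h: "h \<in> {..<2 * ?m} \<rightarrow> space (cube K d)"
    using e p(1) by (auto simp: h_def)
  have sep: "?\<epsilon> \<le> sup_dist K d (h i) (h j)" if ij: "i < 2 * ?m" "j < 2 * ?m" "i \<noteq> j" for i j
  proof -
    have "e i \<in> ?Q" "e j \<in> ?Q" "e i \<noteq> e j"
      using ij e by (auto dest: inj_onD)
    then show ?thesis
      unfolding h_def o_def using grid_separated[where K = K and d = d and p = p, OF M(1) p(2)] by blast
  qed
  have base: "1 \<in> {1..K}" "1 \<in> {1..d 1}" using K d[of 1] by auto
  let ?U = "\<lambda>\<sigma>. uniform_points (cube K d) ?m (signed_points ?m h \<sigma>)"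
  let ?R = "\<lambda>\<mu>. \<integral>\<^sup>+ x. wasserstein (sup_dist K d) (E x) \<mu> \<partial>(PiM {1..n} (\<lambda>_. \<mu>))"
  have U: "?U \<sigma> \<in> P_CI K d" for \<sigma>
    unfolding uniform_points_def
  proof (rule distr_finite_range_in_P_CI)
    show "prob_space (uniform_count_measure {..<?m})"
      using n by (intro prob_space_uniform_count_measure) (auto simp: lessThan_empty_iff)
    show "signed_points ?m h \<sigma> \<in> uniform_count_measure {..<?m} \<rightarrow>\<^sub>M count_space (p ` ?Q)"
      using e(2) by (auto simp: measurable_uniform_count_measure_iff signed_points_def h_def Pi_iff
        intro!: imageI)
    show "finite (p ` ?Q)" by (simp add: finite_grid_index)
    show "p ` ?Q \<subseteq> space (cube K d)" using p(1) by auto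
  qed (rule p(3))
  have "2 ^ ?m * ennreal (?\<epsilon> / 2) \<le> 2 * (\<Sum>\<sigma>\<in>Pow {..<?m}. ?R (?U \<sigma>))"
  proof (rule average_risk_lower_bound[OF n])
    show "sup_dist K d x z \<le> sup_dist K d x y + sup_dist K d y z" for x y z
      by (rule sup_dist_triangle[where d = d, OF base])
    show "sup_dist K d x x = 0" for x by (rule sup_dist_refl[where d = d, OF base])
    show "?\<epsilon> \<le> sup_dist K d (h i) (h j)" if "i < 2 * ?m" "j < 2 * ?m" "i \<noteq> j" for i j
      using that by (rule sep)
    show "?\<epsilon> > 0" using M(1) by simp
  qed (rule sup_dist_sym sup_dist_measurable singleton_sets_cube h E; assumption?)+
  also have "\<dots> \<le> 2 * (\<Sum>\<sigma>\<in>Pow {..<?m}. ?S)"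
    by (intro mult_left_mono sum_mono SUP_upper U) auto
  also have "\<dots> = 2 ^ ?m * (2 * ?S)"
    by (simp add: card_Pow mult_ac)
  finally have "2 ^ ?m * ennreal (?\<epsilon> / 2) \<le> 2 ^ ?m * (2 * ?S)" .
  \<comment> \<open>After cancelling the finite number of hypotheses, \<open>?S\<close> is at least
    a quarter of the separation \<open>1 / (2 * M)\<close>, that is
    \<open>1 / (8 * M)\<close>.\<close>
  then have "ennreal (?\<epsilon> / 2) \<le> 2 * ?S"
    by (subst (asm) ennreal_mult_le_mult_iff) (auto simp: power_eq_top_ennreal)
  moreover have "ennreal (?\<epsilon> / 2) = 2 * ennreal (1 / (8 * M))"
    by (subst ennreal_numeral[symmetric], subst ennreal_mult[symmetric]) auto
  ultimately have "2 * ennreal (1 / (8 * M)) \<le> 2 * ?S" by simp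
  then show ?thesis
    by (subst (asm) ennreal_mult_le_mult_iff) auto
qed

lemma grid_size_exists:
  assumes "N \<ge> 3" "n > 0"
  obtains M :: nat where "M \<ge> 1" "4 * n \<le> M ^ N" "real M \<le> 4 * real n powr (1 / N)"
proof -
  define a where "a = (4 * real n) powr (1 / N)"
  have a: "a \<ge> 1" unfolding a_def using assms by (intro ge_one_powr_ge_zero) auto
  \<comment> \<open>The least mesh number whose \<open>N\<close>-th power reaches
    \<open>4 * n\<close>. As \<open>a \<ge> 1\<close>, rounding up at most doubles it.\<close>
  define M where "M = nat \<lceil>a\<rceil>"
  have M: "a \<le> M" "real M \<le> a + 1" using a unfolding M_def by linarith+
  have "4 * real n = a ^ N"
    unfolding a_def using assms by (simp add: powr_realpow[symmetric] powr_powr)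
  also have "\<dots> \<le> real M ^ N" using M a by (intro power_mono) auto
  finally have "real (4 * n) \<le> real (M ^ N)" by simp
  then have 1: "4 * n \<le> M ^ N" by (simp only: of_nat_le_iff)
  \<comment> \<open>The factor 4 inside the root contributes at most 2, uniformly in
    \<open>N\<close>; rounding up contributes the other 2.\<close>
  have "(4::real) powr (1 / N) \<le> 4 powr (1 / 2)"
    using assms by (intro powr_mono) (auto simp: field_simps)
  also have "\<dots> = 2" by (simp add: powr_half_sqrt)
  finally have "a \<le> 2 * real n powr (1 / N)"
    unfolding a_def by (subst powr_mult) (auto intro: mult_right_mono)
  then have "real M \<le> 4 * real n powr (1 / N)" using M a by linarith
  moreover have "M \<ge> 1" using a M by linarith
  ultimately show ?thesis using that 1 by blast
qed

theorem theorem4p2: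
  shows "(\<forall>(K::nat) (d::nat \<Rightarrow> nat). K \<ge> 1 \<longrightarrow> (\<forall>k\<in>{1..K}. d k \<ge> 1) \<longrightarrow>
      weak_topology (cube K d) closure_of P_CI K d = space (prob_algebra (cube K d))) \<and>
    (\<exists>C::real. C > 0 \<and>
      (\<forall>(K::nat) (d::nat \<Rightarrow> nat) (n::nat).
        K \<ge> 1 \<longrightarrow> (\<forall>k\<in>{1..K}. d k \<ge> 1) \<longrightarrow> (\<Sum>k=1..K. d k) \<ge> 3 \<longrightarrow> n \<ge> 8 \<longrightarrow>
        (INF E \<in> PiM {1..n} (\<lambda>_. cube K d) \<rightarrow>\<^sub>M prob_algebra (cube K d).
          SUP \<mu> \<in> P_CI K d.
            \<integral>\<^sup>+ x. wasserstein (sup_dist K d) (E x) \<mu> \<partial>(PiM {1..n} (\<lambda>_. \<mu>)))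
        \<ge> ennreal (C * real n powr (- 1 / real (\<Sum>k=1..K. d k)))))"
proof (intro conjI exI[of _ "1/32"] allI impI)
  fix K d n assume K: "K \<ge> (1::nat)" and d: "\<forall>k\<in>{1..K}. d k \<ge> (1::nat)"
    and N: "(\<Sum>k=1..K. d k) \<ge> 3" and n: "n \<ge> (8::nat)"
  let ?N = "\<Sum>k=1..K. d k"
  obtain M :: nat where M: "M \<ge> 1" "4 * n \<le> M ^ ?N" "real M \<le> 4 * real n powr (1 / ?N)"
    using grid_size_exists[OF N, of n] n by auto
  \<comment> \<open>The constant 1/32 is 1/8 from the bound \<open>1 / (8 * M)\<close> times 1/4
    from \<open>M \<le> 4 * n powr (1 / N)\<close>.\<close>
  have "1/32 * real n powr (- 1 / ?N) = 1 / (8 * (4 * real n powr (1 / ?N)))"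
    by (simp add: powr_minus_divide)
  also have "\<dots> \<le> 1 / (8 * M)"
    using M(1,3) n by (intro divide_left_mono) (auto intro!: mult_pos_pos)
  finally have bound: "1/32 * real n powr (- 1 / ?N) \<le> 1 / (8 * M)" .
  show "ennreal (1/32 * real n powr (- 1 / real ?N)) \<le>
      (INF E \<in> PiM {1..n} (\<lambda>_. cube K d) \<rightarrow>\<^sub>M prob_algebra (cube K d).
        SUP \<mu> \<in> P_CI K d. \<integral>\<^sup>+ x. wasserstein (sup_dist K d) (E x) \<mu> \<partial>(PiM {1..n} (\<lambda>_. \<mu>)))"
  proof (rule INF_greatest)
    fix E assume E: "E \<in> PiM {1..n} (\<lambda>_. cube K d) \<rightarrow>\<^sub>M prob_algebra (cube K d)"
    have "ennreal (1 / (8 * M)) \<le> (SUP \<mu> \<in> P_CI K d.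
        \<integral>\<^sup>+ x. wasserstein (sup_dist K d) (E x) \<mu> \<partial>(PiM {1..n} (\<lambda>_. \<mu>)))"
      by (rule minimax_lower_bound[OF K _ _ M(1,2) E]) (use d n in auto)
    with ennreal_leI[OF bound]
    show "ennreal (1/32 * real n powr (- 1 / real ?N)) \<le> (SUP \<mu> \<in> P_CI K d.
        \<integral>\<^sup>+ x. wasserstein (sup_dist K d) (E x) \<mu> \<partial>(PiM {1..n} (\<lambda>_. \<mu>)))"
      by (rule order_trans)
  qed
qed (use P_CI_dense in auto)

end
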